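(* Let $\langle A_0;S_0;T_0;\theta_0\rangle\Longrightarrow^{*}\langle\emptyset;S_n;T_n;\theta_n\rangle$ be an $\textsc{AUnif}$ derivation to a final configuration and let $s\triangleq_x t\in A_0\cup S_0$. Then $x\theta_n\tau\in\mathcal{G}_{\mathtt{Abs}}(s,t)$ for every $\tau\in\Psi(T_n,S_n)$.
   Context: Terms are built over variables $\mathcal{V}$ and function symbols $\mathcal{F}$ containing a special constant $\star$ (wild card); $\mathcal{V}(t)$ is the variable set of $t$; $head(x)=x$, $head(f(t_1,\dots,t_n))=f$. Substitutions are postfix; $\mathit{Dom}(\sigma)=\{x\mid x\sigma\neq x\}$; $\mathit{Rvar}(\sigma)$ is the set of variables in its range. An absorption theory $\mathtt{Abs}$ is a finite union of axiom sets $\{f(x,\varepsilon_f)\approx\varepsilon_f, f(\varepsilon_f,x)\approx\varepsilon_f\}$ for pairwise distinct binary $f$; $f,\varepsilon_f$ are related absorption symbols; $\approx_{\mathtt{Abs}}$ the induced equality; $r\preceq_{\mathtt{Abs}}s$ iff $r\sigma\approx_{\mathtt{Abs}}s$ for some $\sigma$; $\mathcal{G}_{\mathtt{Abs}}(s,t)=\{r\mid r\preceq_{\mathtt{Abs}}s,\ r\preceq_{\mathtt{Abs}}t\}$. A term is in $\mathtt{Abs}$-normal form if no $\varepsilon_f$ occurs as an argument of $f$. An AUE is $s\triangleq_x t$ with label $x$; valid sets have pairwise distinct labels; wild AUE: a side is $\star$; solved AUE: $head(s)\neq head(t)$, not related absorption symbols, not wild. A configuration $\langle A;S;T;\theta\rangle$: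 $A$ valid set of AUEs, $S$ valid set of solved AUEs, $T$ valid set of wild AUEs, $\theta$ a substitution, all terms $\mathtt{Abs}$-normal, $labels(A),labels(S),labels(T),\mathit{Dom}(\theta)$ pairwise disjoint, $\mathit{Rvar}(\theta)=labels(A)\cup labels(S)\cup labels(T)$. Rules of $\textsc{AUnif}$ ($\uplus$ disjoint union; $y_i$ fresh; $f$ in Exp rules an absorption symbol): (Dec) $\langle\{f(s_1,\dots,s_n)\triangleq_x f(t_1,\dots,t_n)\}\uplus A;S;T;\theta\rangle\Longrightarrow\langle\{s_i\triangleq_{y_i}t_i\}_{i=1}^n\cup A;S;T;\theta\{x\mapsto f(y_1,\dots,y_n)\}\rangle$, $n\ge0$. (Sol) $\langle\{s\triangleq_x t\}\uplus A;S;T;\theta\rangle\Longrightarrow\langle A;\{s\triangleq_x t\}\cup S;T;\theta\rangle$ if $head(s)\neq head(t)$ and they are not related absorption symbols. (ExpLA1) $\langle\{\varepsilon_f\triangleq_x f(t_1,t_2)\}\uplus A;S;T;\theta\rangle\Longrightarrow\langle\{\varepsilon_f\triangleq_{y_1}t_1\}\cup A;S;\{\star\triangleq_{y_2}t_2\}\cup T;\theta\{x\mapsto f(y_1,y_2)\}\rangle$. (ExpLA2) same left side $\Longrightarrow\langle\{\varepsilon_f\triangleq_{y_2}t_2\}\cup A;S;\{\star\triangleq_{y_1}t_1\}\cup T;\theta\{x\mapsto f(y_1,y_2)\}\rangle$. (ExpRA1) $\langle\{f(s_1,s_2)\triangleq_x\varepsilon_f\}\uplus A;S;T;\theta\rangle\Longrightarrow\langle\{s_1\triangleq_{y_1}\varepsilon_f\}\cup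 A;S;\{s_2\triangleq_{y_2}\star\}\cup T;\theta\{x\mapsto f(y_1,y_2)\}\rangle$. (ExpRA2) same left side $\Longrightarrow\langle\{s_2\triangleq_{y_2}\varepsilon_f\}\cup A;S;\{s_1\triangleq_{y_1}\star\}\cup T;\theta\{x\mapsto f(y_1,y_2)\}\rangle$. (Mer) $\langle\emptyset;\{s\triangleq_x t,s\triangleq_y t\}\cup S;T;\theta\rangle\Longrightarrow\langle\emptyset;\{s\triangleq_y t\}\cup S;T;\theta\{x\mapsto y\}\rangle$. A final configuration is one reached by a finite derivation to which no rule applies. $\sigma_W=\{y\mapsto s\mid s\triangleq_y t\in W\}$, $\rho_W=\{y\mapsto t\mid s\triangleq_y t\in W\}$. Abstraction set: $\uparrow(t,\sigma)=\{r\mid r\sigma\approx_{\mathtt{Abs}}t,\ r\ \mathtt{Abs}\text{-normal},\ \mathcal{V}(r)\subseteq\mathit{Dom}(\sigma)\}$. $\Psi(T,S)$ is the set of substitutions $\tau$ with $\mathit{Dom}(\tau)=labels(T)$ such that $y\tau\in\uparrow(t,\rho_S)$ if $\star\triangleq_y t\in T$ and $y\tau\in\uparrow(s,\sigma_S)$ if $s\triangleq_y\star\in T$ (so $\Psi(\emptyset,S)=\{\mathrm{id}\}$). *)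

theory Defs
  imports Main
begin

datatype ('f, 'v) trm = Var 'v | Fn 'f "('f, 'v) trm list"

text \<open>The type \<open>'f\<close> is the set of function symbols. An absorption theory is
  given by the finite map \<open>absorb\<close> from each absorption symbol \<open>f\<close> to its
  constant \<open>\<epsilon>\<^sub>f\<close>.\<close>

record 'f abs_sig =
  arity :: "'f \<Rightarrow> nat"
  star :: 'f
  absorb :: "'f \<rightharpoonup> 'f"

definition absorption_theory :: "'f abs_sig \<Rightarrow> bool" where
  "absorption_theory \<Sigma> \<longleftrightarrow>
     arity \<Sigma> (star \<Sigma>) = 0 \<and>
     finite (dom (absorb \<Sigma>)) \<and>
     (\<forall>f e. absorb \<Sigma> f = Some e \<longrightarrow> arity \<Sigma> f = 2 \<and> arity \<Sigma> e = 0)"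

abbreviation wild :: "'f abs_sig \<Rightarrow> ('f, 'v) trm" where
  "wild \<Sigma> \<equiv> Fn (star \<Sigma>) []"

fun wf_trm :: "'f abs_sig \<Rightarrow> ('f, 'v) trm \<Rightarrow> bool" where
  "wf_trm \<Sigma> (Var x) \<longleftrightarrow> True"
| "wf_trm \<Sigma> (Fn f ts) \<longleftrightarrow> length ts = arity \<Sigma> f \<and> (\<forall>t \<in> set ts. wf_trm \<Sigma> t)"

fun vars :: "('f, 'v) trm \<Rightarrow> 'v set" where
  "vars (Var x) = {x}"
| "vars (Fn f ts) = (\<Union>t \<in> set ts. vars t)"

fun head :: "('f, 'v) trm \<Rightarrow> 'v + 'f" where
  "head (Var x) = Inl x"
| "head (Fn f ts) = Inr f"


subsection \<open>Substitutions\<close>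

type_synonym ('f, 'v) subst = "'v \<Rightarrow> ('f, 'v) trm"

fun subst_apply :: "('f, 'v) trm \<Rightarrow> ('f, 'v) subst \<Rightarrow> ('f, 'v) trm" (infixl "\<cdot>" 67) where
  "Var x \<cdot> \<sigma> = \<sigma> x"
| "Fn f ts \<cdot> \<sigma> = Fn f (map (\<lambda>t. t \<cdot> \<sigma>) ts)"

definition subst_compose :: "('f, 'v) subst \<Rightarrow> ('f, 'v) subst \<Rightarrow> ('f, 'v) subst"
    (infixl "\<circ>\<^sub>s" 75) where
  "\<sigma> \<circ>\<^sub>s \<tau> = (\<lambda>x. \<sigma> x \<cdot> \<tau>)"

definition Dom :: "('f, 'v) subst \<Rightarrow> 'v set" where
  "Dom \<sigma> = {x. \<sigma> x \<noteq> Var x}"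

definition Rvar :: "('f, 'v) subst \<Rightarrow> 'v set" where
  "Rvar \<sigma> = (\<Union>x \<in> Dom \<sigma>. vars (\<sigma> x))"

definition is_subst :: "'f abs_sig \<Rightarrow> ('f, 'v) subst \<Rightarrow> bool" where
  "is_subst \<Sigma> \<sigma> \<longleftrightarrow> finite (Dom \<sigma>) \<and> (\<forall>x. wf_trm \<Sigma> (\<sigma> x))"


subsection \<open>Equality modulo absorption\<close>

definition abs_axioms :: "'f abs_sig \<Rightarrow> (('f, 'v) trm \<times> ('f, 'v) trm) set" where
  "abs_axioms \<Sigma> =
     {(Fn f [Var x, Fn e []], Fn e []) | f e x. absorb \<Sigma> f = Some e} \<union>
     {(Fn f [Fn e [], Var x], Fn e []) | f e x. absorb \<Sigma> f = Some e}"

inductive abs_eq :: "'f abs_sig \<Rightarrow> ('f, 'v) trm \<Rightarrow> ('f, 'v) trm \<Rightarrow> bool" for \<Sigma> where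
  abs_eq_ax: "(l, r) \<in> abs_axioms \<Sigma> \<Longrightarrow> is_subst \<Sigma> \<sigma> \<Longrightarrow> abs_eq \<Sigma> (l \<cdot> \<sigma>) (r \<cdot> \<sigma>)"
| abs_eq_refl: "wf_trm \<Sigma> t \<Longrightarrow> abs_eq \<Sigma> t t"
| abs_eq_sym: "abs_eq \<Sigma> s t \<Longrightarrow> abs_eq \<Sigma> t s"
| abs_eq_trans: "abs_eq \<Sigma> s t \<Longrightarrow> abs_eq \<Sigma> t u \<Longrightarrow> abs_eq \<Sigma> s u"
| abs_eq_cong: "length ss = arity \<Sigma> f \<Longrightarrow> list_all2 (abs_eq \<Sigma>) ss ts \<Longrightarrow>
    abs_eq \<Sigma> (Fn f ss) (Fn f ts)"

definition more_general :: "'f abs_sig \<Rightarrow> ('f, 'v) trm \<Rightarrow> ('f, 'v) trm \<Rightarrow> bool" where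
  "more_general \<Sigma> r s \<longleftrightarrow> (\<exists>\<sigma>. is_subst \<Sigma> \<sigma> \<and> abs_eq \<Sigma> (r \<cdot> \<sigma>) s)"

definition generalizations :: "'f abs_sig \<Rightarrow> ('f, 'v) trm \<Rightarrow> ('f, 'v) trm \<Rightarrow> ('f, 'v) trm set" where
  "generalizations \<Sigma> s t =
     {r. wf_trm \<Sigma> r \<and> more_general \<Sigma> r s \<and> more_general \<Sigma> r t}"

fun abs_normal :: "'f abs_sig \<Rightarrow> ('f, 'v) trm \<Rightarrow> bool" where
  "abs_normal \<Sigma> (Var x) \<longleftrightarrow> True"
| "abs_normal \<Sigma> (Fn f ts) \<longleftrightarrow>
     (\<forall>t \<in> set ts. abs_normal \<Sigma> t) \<and>
     (\<forall>e. absorb \<Sigma> f = Some e \<longrightarrow> Fn e [] \<notin> set ts)"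

definition related :: "'f abs_sig \<Rightarrow> 'v + 'f \<Rightarrow> 'v + 'f \<Rightarrow> bool" where
  "related \<Sigma> h k \<longleftrightarrow>
     (\<exists>f e. absorb \<Sigma> f = Some e \<and> (h = Inr f \<and> k = Inr e \<or> h = Inr e \<and> k = Inr f))"


subsection \<open>Anti-unification equations and configurations\<close>

text \<open>\<open>AUE s x t\<close> is the equation between \<open>s\<close> and \<open>t\<close> with label \<open>x\<close>.\<close>

datatype ('f, 'v) aue = AUE (lhs: "('f, 'v) trm") (label: 'v) (rhs: "('f, 'v) trm")

definition labels :: "('f, 'v) aue set \<Rightarrow> 'v set" where
  "labels W = label ` W"

definition aue_vars :: "('f, 'v) aue set \<Rightarrow> 'v set" where
  "aue_vars W = (\<Union>a \<in> W. vars (lhs a) \<union> vars (rhs a))"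

definition valid :: "('f, 'v) aue set \<Rightarrow> bool" where
  "valid W \<longleftrightarrow> inj_on label W"

definition wild_aue :: "'f abs_sig \<Rightarrow> ('f, 'v) aue \<Rightarrow> bool" where
  "wild_aue \<Sigma> a \<longleftrightarrow> lhs a = wild \<Sigma> \<or> rhs a = wild \<Sigma>"

definition solved_aue :: "'f abs_sig \<Rightarrow> ('f, 'v) aue \<Rightarrow> bool" where
  "solved_aue \<Sigma> a \<longleftrightarrow>
     head (lhs a) \<noteq> head (rhs a) \<and>
     \<not> related \<Sigma> (head (lhs a)) (head (rhs a)) \<and>
     \<not> wild_aue \<Sigma> a"

type_synonym ('f, 'v) config =
  "('f, 'v) aue set \<times> ('f, 'v) aue set \<times> ('f, 'v) aue set \<times> ('f, 'v) subst"

fun configuration :: "'f abs_sig \<Rightarrow> ('f, 'v) config \<Rightarrow> bool" where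
  "configuration \<Sigma> (A, S, T, \<theta>) \<longleftrightarrow>
     valid A \<and> valid S \<and> valid T \<and>
     (\<forall>a \<in> S. solved_aue \<Sigma> a) \<and>
     (\<forall>a \<in> T. wild_aue \<Sigma> a) \<and>
     is_subst \<Sigma> \<theta> \<and>
     (\<forall>a \<in> A \<union> S \<union> T. wf_trm \<Sigma> (lhs a) \<and> wf_trm \<Sigma> (rhs a)) \<and>
     (\<forall>a \<in> A \<union> S \<union> T. abs_normal \<Sigma> (lhs a) \<and> abs_normal \<Sigma> (rhs a)) \<and>
     (\<forall>x. abs_normal \<Sigma> (\<theta> x)) \<and>
     labels A \<inter> labels S = {} \<and> labels A \<inter> labels T = {} \<and> labels S \<inter> labels T = {} \<and>
     labels A \<inter> Dom \<theta> = {} \<and> labels S \<inter> Dom \<theta> = {} \<and> labels T \<inter> Dom \<theta> = {} \<and>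
     Rvar \<theta> = labels A \<union> labels S \<union> labels T"

fun config_vars :: "('f, 'v) config \<Rightarrow> 'v set" where
  "config_vars (A, S, T, \<theta>) =
     labels (A \<union> S \<union> T) \<union> aue_vars (A \<union> S \<union> T) \<union> Dom \<theta> \<union> Rvar \<theta>"

definition fresh :: "'v list \<Rightarrow> ('f, 'v) config \<Rightarrow> bool" where
  "fresh ys C \<longleftrightarrow> distinct ys \<and> set ys \<inter> config_vars C = {}"


subsection \<open>The rules of AUnif\<close>

text \<open>Disjoint unions are written as \<open>insert a A\<close> with the premise \<open>a \<notin> A\<close>. In
  \<open>Mer\<close> the labels are distinct and the equation labelled \<open>x\<close> really is removed:
  otherwise the rule would apply forever, or \<open>x\<close> would be both a label and in
  the domain of the new substitution.\<close>

inductive aunif :: "'f abs_sig \<Rightarrow> ('f, 'v) config \<Rightarrow> ('f, 'v) config \<Rightarrow> bool" for \<Sigma> where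
  Dec: "\<lbrakk> AUE (Fn f ss) x (Fn f ts) \<notin> A;
          length ss = length ys; length ts = length ys;
          fresh ys (insert (AUE (Fn f ss) x (Fn f ts)) A, S, T, \<theta>) \<rbrakk> \<Longrightarrow>
    aunif \<Sigma> (insert (AUE (Fn f ss) x (Fn f ts)) A, S, T, \<theta>)
      ({AUE (ss ! i) (ys ! i) (ts ! i) | i. i < length ys} \<union> A, S, T,
       \<theta> \<circ>\<^sub>s Var(x := Fn f (map Var ys)))"
| Sol: "\<lbrakk> AUE s x t \<notin> A; head s \<noteq> head t; \<not> related \<Sigma> (head s) (head t) \<rbrakk> \<Longrightarrow>
    aunif \<Sigma> (insert (AUE s x t) A, S, T, \<theta>) (A, insert (AUE s x t) S, T, \<theta>)"
| ExpLA1: "\<lbrakk> absorb \<Sigma> f = Some e;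
          AUE (Fn e []) x (Fn f [t1, t2]) \<notin> A;
          fresh [y1, y2] (insert (AUE (Fn e []) x (Fn f [t1, t2])) A, S, T, \<theta>) \<rbrakk> \<Longrightarrow>
    aunif \<Sigma> (insert (AUE (Fn e []) x (Fn f [t1, t2])) A, S, T, \<theta>)
      (insert (AUE (Fn e []) y1 t1) A, S, insert (AUE (wild \<Sigma>) y2 t2) T,
       \<theta> \<circ>\<^sub>s Var(x := Fn f [Var y1, Var y2]))"
| ExpLA2: "\<lbrakk> absorb \<Sigma> f = Some e;
          AUE (Fn e []) x (Fn f [t1, t2]) \<notin> A;
          fresh [y1, y2] (insert (AUE (Fn e []) x (Fn f [t1, t2])) A, S, T, \<theta>) \<rbrakk> \<Longrightarrow>
    aunif \<Sigma> (insert (AUE (Fn e []) x (Fn f [t1, t2])) A, S, T, \<theta>)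
      (insert (AUE (Fn e []) y2 t2) A, S, insert (AUE (wild \<Sigma>) y1 t1) T,
       \<theta> \<circ>\<^sub>s Var(x := Fn f [Var y1, Var y2]))"
| ExpRA1: "\<lbrakk> absorb \<Sigma> f = Some e;
          AUE (Fn f [s1, s2]) x (Fn e []) \<notin> A;
          fresh [y1, y2] (insert (AUE (Fn f [s1, s2]) x (Fn e [])) A, S, T, \<theta>) \<rbrakk> \<Longrightarrow>
    aunif \<Sigma> (insert (AUE (Fn f [s1, s2]) x (Fn e [])) A, S, T, \<theta>)
      (insert (AUE s1 y1 (Fn e [])) A, S, insert (AUE s2 y2 (wild \<Sigma>)) T,
       \<theta> \<circ>\<^sub>s Var(x := Fn f [Var y1, Var y2]))"
| ExpRA2: "\<lbrakk> absorb \<Sigma> f = Some e;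
          AUE (Fn f [s1, s2]) x (Fn e []) \<notin> A;
          fresh [y1, y2] (insert (AUE (Fn f [s1, s2]) x (Fn e [])) A, S, T, \<theta>) \<rbrakk> \<Longrightarrow>
    aunif \<Sigma> (insert (AUE (Fn f [s1, s2]) x (Fn e [])) A, S, T, \<theta>)
      (insert (AUE s2 y2 (Fn e [])) A, S, insert (AUE s1 y1 (wild \<Sigma>)) T,
       \<theta> \<circ>\<^sub>s Var(x := Fn f [Var y1, Var y2]))"
| Mer: "\<lbrakk> x \<noteq> y; AUE s x t \<notin> S \<rbrakk> \<Longrightarrow>
    aunif \<Sigma> ({}, insert (AUE s x t) (insert (AUE s y t) S), T, \<theta>)
      ({}, insert (AUE s y t) S, T, \<theta> \<circ>\<^sub>s Var(x := Var y))"

definition final :: "'f abs_sig \<Rightarrow> ('f, 'v) config \<Rightarrow> bool" where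
  "final \<Sigma> C \<longleftrightarrow> \<not> (\<exists>C'. aunif \<Sigma> C C')"


subsection \<open>Abstraction sets\<close>

text \<open>The definite descriptions below are meaningful for valid sets of equations.\<close>

definition lsubst :: "('f, 'v) aue set \<Rightarrow> ('f, 'v) subst" where
  "lsubst W y = (if y \<in> labels W then lhs (THE a. a \<in> W \<and> label a = y) else Var y)"

definition rsubst :: "('f, 'v) aue set \<Rightarrow> ('f, 'v) subst" where
  "rsubst W y = (if y \<in> labels W then rhs (THE a. a \<in> W \<and> label a = y) else Var y)"

definition abstraction_set :: "'f abs_sig \<Rightarrow> ('f, 'v) trm \<Rightarrow> ('f, 'v) subst \<Rightarrow> ('f, 'v) trm set" where
  "abstraction_set \<Sigma> t \<sigma> =
     {r. wf_trm \<Sigma> r \<and> abs_eq \<Sigma> (r \<cdot> \<sigma>) t \<and> abs_normal \<Sigma> r \<and> vars r \<subseteq> Dom \<sigma>}"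

definition Psi :: "'f abs_sig \<Rightarrow> ('f, 'v) aue set \<Rightarrow> ('f, 'v) aue set \<Rightarrow> ('f, 'v) subst set" where
  "Psi \<Sigma> T S =
     {\<tau>. is_subst \<Sigma> \<tau> \<and> Dom \<tau> = labels T \<and>
        (\<forall>y t. AUE (wild \<Sigma>) y t \<in> T \<longrightarrow> \<tau> y \<in> abstraction_set \<Sigma> t (rsubst S)) \<and>
        (\<forall>y s. AUE s y (wild \<Sigma>) \<in> T \<longrightarrow> \<tau> y \<in> abstraction_set \<Sigma> s (lsubst S))}"

end

theory Submission
  imports Defs
begin

text \<open>\<open>AUnif\<close> treats the two sides of equations symmetrically, so it suffices to show that
  \<open>x\<theta>\<^sub>n\<tau>\<close> generalizes the left side \<open>s\<close>. Say that a substitution solves a configuration if it sends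
  the label of every equation in \<open>A \<union> S\<close>, and of every equation \<open>s \<triangleq> \<star>\<close> in \<open>T\<close>, to its left side
  modulo absorption. Each rule composes \<open>\<theta>\<close> with an elementary substitution \<open>\<delta>\<close>, and if \<open>\<sigma>\<close> solves
  the configuration after a step then \<open>\<delta>\<sigma>\<close> solves the one before it: when \<open>\<epsilon>\<^sub>f \<triangleq> f(t\<^sub>1, t\<^sub>2)\<close> is
  expanded, the argument without obligation is absorbed by the other one, which becomes \<open>\<epsilon>\<^sub>f\<close>. For
  \<open>\<tau>\<close> in \<open>\<Psi>(T\<^sub>n, S\<^sub>n)\<close> the substitution \<open>\<tau>\<sigma>\<^sub>S\<close> with \<open>S = S\<^sub>n\<close> solves the final configuration; pulled
  back to the initial one, it sends \<open>x\<close> to \<open>x\<theta>\<^sub>n\<tau>\<sigma>\<^sub>S\<close>, which is therefore equal to \<open>s\<close> modulo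
  absorption.\<close>

subsection \<open>Substitutions\<close>

lemma subst_apply_compose: "t \<cdot> (\<sigma> \<circ>\<^sub>s \<tau>) = t \<cdot> \<sigma> \<cdot> \<tau>"
  by (induction t) (auto simp: subst_compose_def)

lemma subst_compose_assoc: "\<sigma> \<circ>\<^sub>s \<tau> \<circ>\<^sub>s \<upsilon> = \<sigma> \<circ>\<^sub>s (\<tau> \<circ>\<^sub>s \<upsilon>)"
  by (simp add: subst_compose_def fun_eq_iff flip: subst_apply_compose)

lemma finite_vars: "finite (vars t)"
  by (induction t) auto

definition wf_subst :: "'f abs_sig \<Rightarrow> ('f, 'v) subst \<Rightarrow> bool" where
  "wf_subst \<Sigma> \<sigma> \<longleftrightarrow> (\<forall>x. wf_trm \<Sigma> (\<sigma> x))"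

lemma wf_subst_apply: "wf_trm \<Sigma> t \<Longrightarrow> wf_subst \<Sigma> \<sigma> \<Longrightarrow> wf_trm \<Sigma> (t \<cdot> \<sigma>)"
  by (induction t) (auto simp: wf_subst_def)

lemma wf_subst_compose: "wf_subst \<Sigma> \<sigma> \<Longrightarrow> wf_subst \<Sigma> \<tau> \<Longrightarrow> wf_subst \<Sigma> (\<sigma> \<circ>\<^sub>s \<tau>)"
  by (simp add: wf_subst_def subst_compose_def wf_subst_apply)

lemma wf_subst_Var_upd: "wf_trm \<Sigma> t \<Longrightarrow> wf_subst \<Sigma> (Var(x := t))"
  by (simp add: wf_subst_def)

lemma is_subst_imp_wf_subst: "is_subst \<Sigma> \<sigma> \<Longrightarrow> wf_subst \<Sigma> \<sigma>"
  by (simp add: is_subst_def wf_subst_def)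

lemma is_subst_Var_upd: "wf_trm \<Sigma> t \<Longrightarrow> is_subst \<Sigma> (Var(x := t))"
  by (auto simp: is_subst_def Dom_def intro: finite_subset[of _ "{x}"])


subsection \<open>Absorption\<close>

lemma absorption_theory_arity:
  "absorption_theory \<Sigma> \<Longrightarrow> absorb \<Sigma> f = Some e \<Longrightarrow> arity \<Sigma> f = 2"
  by (simp add: absorption_theory_def)

lemma abs_eq_cong_binary:
  "arity \<Sigma> f = 2 \<Longrightarrow> abs_eq \<Sigma> u u' \<Longrightarrow> abs_eq \<Sigma> v v' \<Longrightarrow> abs_eq \<Sigma> (Fn f [u, v]) (Fn f [u', v'])"
  by (rule abs_eq_cong) simp_all

lemma abs_eq_axiom_instance:
  assumes "absorb \<Sigma> f = Some e" "wf_trm \<Sigma> v"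
  shows "abs_eq \<Sigma> (Fn f [Fn e [], v]) (Fn e [])" "abs_eq \<Sigma> (Fn f [v, Fn e []]) (Fn e [])"
proof -
  fix x
  have "abs_eq \<Sigma> (Fn f [Fn e [], Var x] \<cdot> Var(x := v)) (Fn e [] \<cdot> Var(x := v))"
    "abs_eq \<Sigma> (Fn f [Var x, Fn e []] \<cdot> Var(x := v)) (Fn e [] \<cdot> Var(x := v))"
    using assms by (intro abs_eq_ax is_subst_Var_upd; auto simp: abs_axioms_def)+
  then show "abs_eq \<Sigma> (Fn f [Fn e [], v]) (Fn e [])" "abs_eq \<Sigma> (Fn f [v, Fn e []]) (Fn e [])"
    by simp_all
qed

lemma abs_eq_absorb:
  assumes "absorption_theory \<Sigma>" "absorb \<Sigma> f = Some e" "abs_eq \<Sigma> u (Fn e [])" "wf_trm \<Sigma> v"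
  shows "abs_eq \<Sigma> (Fn f [u, v]) (Fn e [])" "abs_eq \<Sigma> (Fn f [v, u]) (Fn e [])"
  using absorption_theory_arity[OF assms(1,2)] assms(3,4)
    abs_eq_axiom_instance[OF assms(2,4)]
  by (blast intro: abs_eq_trans abs_eq_cong_binary abs_eq_refl)+


subsection \<open>Well-formed configurations\<close>

definition wf_aue :: "'f abs_sig \<Rightarrow> ('f, 'v) aue \<Rightarrow> bool" where
  "wf_aue \<Sigma> a \<longleftrightarrow> wf_trm \<Sigma> (lhs a) \<and> wf_trm \<Sigma> (rhs a)"

text \<open>Being a \<open>configuration\<close> is not preserved by \<open>aunif\<close>, because \<open>Sol\<close> may move a wild equation
  into the solved set.\<close>

fun wf_config :: "'f abs_sig \<Rightarrow> ('f, 'v) config \<Rightarrow> bool" where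
  "wf_config \<Sigma> (A, S, T, \<theta>) \<longleftrightarrow>
     inj_on label (A \<union> S \<union> T) \<and> (A \<union> S) \<inter> T = {} \<and> finite (A \<union> S \<union> T) \<and>
     (\<forall>a \<in> A \<union> S \<union> T. wf_aue \<Sigma> a) \<and> wf_subst \<Sigma> \<theta>"

lemma configuration_imp_wf_config:
  assumes "configuration \<Sigma> (A, S, T, \<theta>)"
  shows "wf_config \<Sigma> (A, S, T, \<theta>)"
proof -
  have inj: "inj_on label (A \<union> S \<union> T)"
    using assms by (auto simp: valid_def labels_def inj_on_Un)
  have "finite (Dom \<theta>)"
    using assms by (simp add: is_subst_def)
  then have "finite (Rvar \<theta>)"
    by (simp add: Rvar_def finite_vars)
  moreover have "label ` (A \<union> S \<union> T) = Rvar \<theta>"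
    using assms by (simp add: labels_def image_Un)
  ultimately have "finite (A \<union> S \<union> T)"
    using inj by (metis finite_imageD)
  moreover have "(A \<union> S) \<inter> T = {}"
    using assms by (auto simp: labels_def)
  ultimately show ?thesis
    using inj assms by (simp add: is_subst_imp_wf_subst wf_aue_def)
qed

lemma wf_config_replace:
  assumes wf: "wf_config \<Sigma> (insert a A, S, T, \<theta>)"
    and fresh: "fresh ys (insert a A, S, T, \<theta>)" "label ` (N \<union> M) \<subseteq> set ys"
    and new: "inj_on label (N \<union> M)" "N \<inter> M = {}" "finite (N \<union> M)" "\<forall>b \<in> N \<union> M. wf_aue \<Sigma> b"
    and "wf_trm \<Sigma> u"
  shows "wf_config \<Sigma> (N \<union> A, S, M \<union> T, \<theta> \<circ>\<^sub>s Var(x := u))"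
proof -
  have disj: "label ` (N \<union> M) \<inter> label ` (A \<union> S \<union> T) = {}"
    using fresh by (auto simp: fresh_def labels_def)
  have "inj_on label (A \<union> S \<union> T)"
    using wf by (auto intro: inj_on_subset)
  with new(1) disj have "inj_on label ((N \<union> M) \<union> (A \<union> S \<union> T))"
    unfolding inj_on_Un[of _ "N \<union> M"] by blast
  moreover have "(N \<union> M) \<union> (A \<union> S \<union> T) = (N \<union> A) \<union> S \<union> (M \<union> T)"
    by blast
  moreover have "((N \<union> A) \<union> S) \<inter> (M \<union> T) = {}"
    using wf new(2) disj by auto
  moreover have "wf_subst \<Sigma> (\<theta> \<circ>\<^sub>s Var(x := u))"
    using wf \<open>wf_trm \<Sigma> u\<close> by (simp add: wf_subst_compose wf_subst_Var_upd)
  ultimately show ?thesis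
    using wf new(3,4) by auto
qed

lemma wf_config_Dec:
  assumes wf: "wf_config \<Sigma> (insert (AUE (Fn f ss) x (Fn f ts)) A, S, T, \<theta>)"
    and len: "length ss = length ys" "length ts = length ys"
    and fresh: "fresh ys (insert (AUE (Fn f ss) x (Fn f ts)) A, S, T, \<theta>)"
  shows "wf_config \<Sigma> ({AUE (ss ! i) (ys ! i) (ts ! i) | i. i < length ys} \<union> A, S, T,
    \<theta> \<circ>\<^sub>s Var(x := Fn f (map Var ys)))"
proof -
  define N where "N = (\<lambda>i. AUE (ss ! i) (ys ! i) (ts ! i)) ` {..<length ys}"
  have "label ` (N \<union> {}) \<subseteq> set ys" "finite (N \<union> {})"
    by (auto simp: N_def)
  moreover have "inj_on label (N \<union> {})"
    using fresh by (auto simp: N_def inj_on_def fresh_def nth_eq_iff_index_eq)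
  moreover have "\<forall>b \<in> N \<union> {}. wf_aue \<Sigma> b"
    using wf len by (auto simp: N_def wf_aue_def)
  moreover have "wf_trm \<Sigma> (Fn f (map Var ys))"
    using wf len by (simp add: wf_aue_def)
  ultimately have "wf_config \<Sigma> (N \<union> A, S, {} \<union> T, \<theta> \<circ>\<^sub>s Var(x := Fn f (map Var ys)))"
    using wf fresh by (intro wf_config_replace) auto
  moreover have "N = {AUE (ss ! i) (ys ! i) (ts ! i) | i. i < length ys}"
    by (auto simp: N_def)
  ultimately show ?thesis
    by simp
qed

lemma wf_config_Exp:
  assumes "absorption_theory \<Sigma>" "absorb \<Sigma> f = Some e"
    and "wf_config \<Sigma> (insert a A, S, T, \<theta>)" "fresh [y1, y2] (insert a A, S, T, \<theta>)"
    and "wf_aue \<Sigma> b" "wf_aue \<Sigma> c" "{label b, label c} = {y1, y2}"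
  shows "wf_config \<Sigma> (insert b A, S, insert c T, \<theta> \<circ>\<^sub>s Var(x := Fn f [Var y1, Var y2]))"
proof -
  have "y1 \<noteq> y2"
    using assms(4) by (simp add: fresh_def)
  then have "label b \<noteq> label c"
    using assms(7) by (auto simp: doubleton_eq_iff)
  moreover have "wf_trm \<Sigma> (Fn f [Var y1, Var y2])"
    using assms(1,2) by (auto simp: absorption_theory_def)
  ultimately have
    "wf_config \<Sigma> ({b} \<union> A, S, {c} \<union> T, \<theta> \<circ>\<^sub>s Var(x := Fn f [Var y1, Var y2]))"
    using assms(3-7) by (intro wf_config_replace[where ys = "[y1, y2]"]) auto
  then show ?thesis
    by simp
qed

lemma aunif_wf_config:
  assumes "absorption_theory \<Sigma>" "aunif \<Sigma> C C'" "wf_config \<Sigma> C"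
  shows "wf_config \<Sigma> C'"
  using assms(2,3)
proof induction
  case Dec
  then show ?case
    by (intro wf_config_Dec)
next
  case Sol
  then show ?case
    by auto
next
  case ExpLA1
  with assms(1) show ?case
    by (intro wf_config_Exp) (auto simp: wf_aue_def absorption_theory_def)
next
  case ExpLA2
  with assms(1) show ?case
    by (intro wf_config_Exp) (auto simp: wf_aue_def absorption_theory_def)
next
  case ExpRA1
  with assms(1) show ?case
    by (intro wf_config_Exp) (auto simp: wf_aue_def absorption_theory_def)
next
  case ExpRA2
  with assms(1) show ?case
    by (intro wf_config_Exp) (auto simp: wf_aue_def absorption_theory_def)
next
  case Mer
  then show ?case
    by (auto simp: wf_subst_compose wf_subst_Var_upd)
qed

lemma aunif_rtranclp_wf_config:
  assumes "absorption_theory \<Sigma>" "(aunif \<Sigma>)\<^sup>*\<^sup>* C C'" "wf_config \<Sigma> C"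
  shows "wf_config \<Sigma> C'"
  using assms(2,3) by induction (auto intro: aunif_wf_config[OF assms(1)])


subsection \<open>Solutions of the left sides\<close>

fun config_subst :: "('f, 'v) config \<Rightarrow> ('f, 'v) subst" where
  "config_subst (A, S, T, \<theta>) = \<theta>"

fun lhs_obligations :: "'f abs_sig \<Rightarrow> ('f, 'v) config \<Rightarrow> ('f, 'v) aue set" where
  "lhs_obligations \<Sigma> (A, S, T, \<theta>) = A \<union> S \<union> {a \<in> T. rhs a = wild \<Sigma>}"

definition solves_lhs :: "'f abs_sig \<Rightarrow> ('f, 'v) aue set \<Rightarrow> ('f, 'v) subst \<Rightarrow> bool" where
  "solves_lhs \<Sigma> W \<sigma> \<longleftrightarrow> wf_subst \<Sigma> \<sigma> \<and> (\<forall>a \<in> W. abs_eq \<Sigma> (\<sigma> (label a)) (lhs a))"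

lemma solves_lhs_AUE: "solves_lhs \<Sigma> W \<sigma> \<Longrightarrow> AUE s x t \<in> W \<Longrightarrow> abs_eq \<Sigma> (\<sigma> x) s"
  by (force simp: solves_lhs_def)

lemma solves_lhs_bind:
  assumes "solves_lhs \<Sigma> W' \<sigma>" "inj_on label W" "AUE s x t \<in> W" "W \<subseteq> insert (AUE s x t) W'"
    and "wf_trm \<Sigma> u" "abs_eq \<Sigma> (u \<cdot> \<sigma>) s"
  shows "solves_lhs \<Sigma> W (Var(x := u) \<circ>\<^sub>s \<sigma>)"
proof -
  have "abs_eq \<Sigma> ((Var(x := u) \<circ>\<^sub>s \<sigma>) (label b)) (lhs b)" if "b \<in> W" for b
  proof (cases "b = AUE s x t")
    case True
    then show ?thesis
      using assms(6) by (simp add: subst_compose_def)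
  next
    case False
    then have "label b \<noteq> x"
      using inj_onD[OF assms(2) _ that assms(3)] by auto
    moreover have "b \<in> W'"
      using that False assms(4) by blast
    ultimately show ?thesis
      using assms(1) by (simp add: subst_compose_def solves_lhs_def)
  qed
  then show ?thesis
    using assms(1,5) by (simp add: solves_lhs_def wf_subst_compose wf_subst_Var_upd)
qed

definition reflects_lhs_solutions :: "'f abs_sig \<Rightarrow> ('f, 'v) config \<Rightarrow> ('f, 'v) config \<Rightarrow> bool" where
  "reflects_lhs_solutions \<Sigma> C C' \<longleftrightarrow>
     (\<forall>\<sigma>. solves_lhs \<Sigma> (lhs_obligations \<Sigma> C') \<sigma> \<longrightarrow>
       (\<exists>\<sigma>'. solves_lhs \<Sigma> (lhs_obligations \<Sigma> C) \<sigma>' \<and>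
          config_subst C \<circ>\<^sub>s \<sigma>' = config_subst C' \<circ>\<^sub>s \<sigma>))"

lemma reflects_lhs_solutions_refl: "reflects_lhs_solutions \<Sigma> C C"
  by (auto simp: reflects_lhs_solutions_def)

lemma reflects_lhs_solutions_trans:
  "reflects_lhs_solutions \<Sigma> C C' \<Longrightarrow> reflects_lhs_solutions \<Sigma> C' C'' \<Longrightarrow>
    reflects_lhs_solutions \<Sigma> C C''"
  unfolding reflects_lhs_solutions_def by metis

lemma reflects_lhs_solutions_bind:
  assumes "wf_config \<Sigma> C" "AUE s x t \<in> lhs_obligations \<Sigma> C"
    and "lhs_obligations \<Sigma> C \<subseteq> insert (AUE s x t) (lhs_obligations \<Sigma> C')"
    and "config_subst C' = config_subst C \<circ>\<^sub>s Var(x := u)" "wf_trm \<Sigma> u"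
    and "\<And>\<sigma>. solves_lhs \<Sigma> (lhs_obligations \<Sigma> C') \<sigma> \<Longrightarrow> abs_eq \<Sigma> (u \<cdot> \<sigma>) s"
  shows "reflects_lhs_solutions \<Sigma> C C'"
  unfolding reflects_lhs_solutions_def
proof (intro allI impI exI conjI)
  fix \<sigma> assume sol: "solves_lhs \<Sigma> (lhs_obligations \<Sigma> C') \<sigma>"
  have "inj_on label (lhs_obligations \<Sigma> C)"
    using assms(1) by (cases C) (auto intro: inj_on_subset)
  with sol assms show "solves_lhs \<Sigma> (lhs_obligations \<Sigma> C) (Var(x := u) \<circ>\<^sub>s \<sigma>)"
    by (intro solves_lhs_bind)
  show "config_subst C \<circ>\<^sub>s (Var(x := u) \<circ>\<^sub>s \<sigma>) = config_subst C' \<circ>\<^sub>s \<sigma>"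
    by (simp add: assms(4) subst_compose_assoc)
qed

lemma reflects_lhs_solutions_Dec:
  assumes wf: "wf_config \<Sigma> (insert (AUE (Fn f ss) x (Fn f ts)) A, S, T, \<theta>)"
    and len: "length ss = length ys"
  shows "reflects_lhs_solutions \<Sigma> (insert (AUE (Fn f ss) x (Fn f ts)) A, S, T, \<theta>)
    ({AUE (ss ! i) (ys ! i) (ts ! i) | i. i < length ys} \<union> A, S, T,
     \<theta> \<circ>\<^sub>s Var(x := Fn f (map Var ys)))" (is "reflects_lhs_solutions \<Sigma> ?C ?C'")
proof (rule reflects_lhs_solutions_bind[OF wf, of "Fn f ss" x "Fn f ts"])
  have arity: "length ss = arity \<Sigma> f"
    using wf by (simp add: wf_aue_def)
  then show "wf_trm \<Sigma> (Fn f (map Var ys))"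
    using len by simp
  fix \<sigma> assume sol: "solves_lhs \<Sigma> (lhs_obligations \<Sigma> ?C') \<sigma>"
  have "abs_eq \<Sigma> (\<sigma> (ys ! i)) (ss ! i)" if "i < length ys" for i
    using that by (intro solves_lhs_AUE[OF sol]) auto
  then show "abs_eq \<Sigma> (Fn f (map Var ys) \<cdot> \<sigma>) (Fn f ss)"
    using arity len by (auto intro!: abs_eq_cong simp: list_all2_conv_all_nth)
qed auto

lemma reflects_lhs_solutions_Exp:
  assumes "absorption_theory \<Sigma>" "absorb \<Sigma> f = Some e"
    and wf: "wf_config \<Sigma> (insert (AUE s x t) A, S, T, \<theta>)"
    and eq: "\<And>\<sigma>. solves_lhs \<Sigma> (lhs_obligations \<Sigma> (insert b A, S, insert c T, \<theta>)) \<sigma> \<Longrightarrow>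
      abs_eq \<Sigma> (Fn f [\<sigma> y1, \<sigma> y2]) s"
  shows "reflects_lhs_solutions \<Sigma> (insert (AUE s x t) A, S, T, \<theta>)
    (insert b A, S, insert c T, \<theta> \<circ>\<^sub>s Var(x := Fn f [Var y1, Var y2]))"
  using eq absorption_theory_arity[OF assms(1,2)]
  by (intro reflects_lhs_solutions_bind[OF wf, of s x t]) auto

lemma reflects_lhs_solutions_ExpLA:
  assumes abs: "absorption_theory \<Sigma>" "absorb \<Sigma> f = Some e"
    and wf: "wf_config \<Sigma> (insert (AUE (Fn e []) x t) A, S, T, \<theta>)"
    and y: "y \<in> {y1, y2}"
  shows "reflects_lhs_solutions \<Sigma> (insert (AUE (Fn e []) x t) A, S, T, \<theta>)
    (insert (AUE (Fn e []) y t') A, S, insert c T, \<theta> \<circ>\<^sub>s Var(x := Fn f [Var y1, Var y2]))"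
proof (rule reflects_lhs_solutions_Exp[OF abs wf])
  fix \<sigma>
  assume "solves_lhs \<Sigma> (lhs_obligations \<Sigma> (insert (AUE (Fn e []) y t') A, S, insert c T, \<theta>)) \<sigma>"
  then have "abs_eq \<Sigma> (\<sigma> y) (Fn e [])" "wf_trm \<Sigma> (\<sigma> z)" for z
    by (simp_all add: solves_lhs_def wf_subst_def)
  then show "abs_eq \<Sigma> (Fn f [\<sigma> y1, \<sigma> y2]) (Fn e [])"
    using y abs by (auto intro: abs_eq_absorb)
qed

lemma reflects_lhs_solutions_ExpRA:
  assumes abs: "absorption_theory \<Sigma>" "absorb \<Sigma> f = Some e"
    and wf: "wf_config \<Sigma> (insert (AUE (Fn f [s1, s2]) x t) A, S, T, \<theta>)"
    and c: "rhs c = wild \<Sigma>"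
    and args: "{(label b, lhs b), (label c, lhs c)} = {(y1, s1), (y2, s2)}"
  shows "reflects_lhs_solutions \<Sigma> (insert (AUE (Fn f [s1, s2]) x t) A, S, T, \<theta>)
    (insert b A, S, insert c T, \<theta> \<circ>\<^sub>s Var(x := Fn f [Var y1, Var y2]))"
proof (rule reflects_lhs_solutions_Exp[OF abs wf])
  fix \<sigma> assume "solves_lhs \<Sigma> (lhs_obligations \<Sigma> (insert b A, S, insert c T, \<theta>)) \<sigma>"
  then have "abs_eq \<Sigma> (\<sigma> (label b)) (lhs b)" "abs_eq \<Sigma> (\<sigma> (label c)) (lhs c)"
    using c by (simp_all add: solves_lhs_def)
  then have "abs_eq \<Sigma> (\<sigma> y1) s1" "abs_eq \<Sigma> (\<sigma> y2) s2"
    using args by (auto simp: doubleton_eq_iff)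
  then show "abs_eq \<Sigma> (Fn f [\<sigma> y1, \<sigma> y2]) (Fn f [s1, s2])"
    using absorption_theory_arity[OF abs] by (intro abs_eq_cong_binary)
qed

lemma reflects_lhs_solutions_Mer:
  assumes wf: "wf_config \<Sigma> ({}, insert (AUE s x t) (insert (AUE s y t) S), T, \<theta>)"
  shows "reflects_lhs_solutions \<Sigma> ({}, insert (AUE s x t) (insert (AUE s y t) S), T, \<theta>)
    ({}, insert (AUE s y t) S, T, \<theta> \<circ>\<^sub>s Var(x := Var y))"
  by (rule reflects_lhs_solutions_bind[OF wf, of s x t]) (auto simp: solves_lhs_def)

lemma aunif_reflects_lhs_solutions:
  assumes abs: "absorption_theory \<Sigma>" and "aunif \<Sigma> C C'" "wf_config \<Sigma> C"
  shows "reflects_lhs_solutions \<Sigma> C C'"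
  using assms(2,3)
proof induction
  case Dec
  then show ?case
    by (intro reflects_lhs_solutions_Dec)
next
  case Sol
  then show ?case
    by (auto simp: reflects_lhs_solutions_def)
next
  case ExpLA1
  then show ?case
    by (intro reflects_lhs_solutions_ExpLA[OF abs]) simp_all
next
  case ExpLA2
  then show ?case
    by (intro reflects_lhs_solutions_ExpLA[OF abs]) simp_all
next
  case ExpRA1
  then show ?case
    by (intro reflects_lhs_solutions_ExpRA[OF abs]) simp_all
next
  case ExpRA2
  then show ?case
    by (intro reflects_lhs_solutions_ExpRA[OF abs]) auto
next
  case Mer
  then show ?case
    by (intro reflects_lhs_solutions_Mer)
qed

lemma aunif_rtranclp_reflects_lhs_solutions:
  assumes "absorption_theory \<Sigma>" "(aunif \<Sigma>)\<^sup>*\<^sup>* C C'" "wf_config \<Sigma> C"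
  shows "reflects_lhs_solutions \<Sigma> C C'"
  using assms(2,3)
proof (induction rule: converse_rtranclp_induct)
  case base
  show ?case
    by (rule reflects_lhs_solutions_refl)
next
  case (step C D)
  then show ?case
    using aunif_wf_config[OF assms(1)] aunif_reflects_lhs_solutions[OF assms(1)]
      reflects_lhs_solutions_trans by blast
qed


subsection \<open>Generalization of the left sides\<close>

lemma
  assumes "inj_on label W" "a \<in> W"
  shows lsubst_label: "lsubst W (label a) = lhs a"
    and rsubst_label: "rsubst W (label a) = rhs a"
proof -
  have "(THE b. b \<in> W \<and> label b = label a) = a"
    using assms by (auto simp: inj_on_def)
  with assms show "lsubst W (label a) = lhs a" "rsubst W (label a) = rhs a"
    by (simp_all add: lsubst_def rsubst_def labels_def)
qed

lemma is_subst_lsubst: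
  assumes "inj_on label W" "finite W" "\<forall>a \<in> W. wf_trm \<Sigma> (lhs a)"
  shows "is_subst \<Sigma> (lsubst W)"
proof -
  have outside: "lsubst W y = Var y" if "y \<notin> label ` W" for y
    using that by (simp add: lsubst_def labels_def)
  then have "Dom (lsubst W) \<subseteq> label ` W"
    by (auto simp: Dom_def)
  moreover have "wf_trm \<Sigma> (lsubst W y)" for y
    using assms outside by (cases "y \<in> label ` W") (auto simp: lsubst_label)
  ultimately show ?thesis
    using assms(2) by (auto simp: is_subst_def intro: finite_subset)
qed

lemma wf_config_is_subst_lsubst:
  "wf_config \<Sigma> (A, S, T, \<theta>) \<Longrightarrow> is_subst \<Sigma> (lsubst S)"
  by (intro is_subst_lsubst) (auto simp: wf_aue_def intro: inj_on_subset)

lemma Psi_solves_lhs: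
  assumes wf: "wf_config \<Sigma> ({}, S, T, \<theta>)" and \<tau>: "\<tau> \<in> Psi \<Sigma> T S"
  shows "solves_lhs \<Sigma> (lhs_obligations \<Sigma> ({}, S, T, \<theta>)) (\<tau> \<circ>\<^sub>s lsubst S)"
proof -
  have "wf_subst \<Sigma> (\<tau> \<circ>\<^sub>s lsubst S)"
    using \<tau> wf_config_is_subst_lsubst[OF wf]
    by (simp add: Psi_def wf_subst_compose is_subst_imp_wf_subst)
  moreover have "abs_eq \<Sigma> (\<tau> (label a) \<cdot> lsubst S) (lhs a)" if "a \<in> S" for a
  proof -
    have "label a \<notin> labels T"
      using wf that by (auto simp: labels_def inj_on_def)
    then have "\<tau> (label a) = Var (label a)"
      using \<tau> by (auto simp: Psi_def Dom_def)
    moreover have "lsubst S (label a) = lhs a"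
      using wf that by (intro lsubst_label) (auto intro: inj_on_subset)
    ultimately show ?thesis
      using wf that by (auto simp: wf_aue_def intro: abs_eq_refl)
  qed
  moreover have "abs_eq \<Sigma> (\<tau> (label a) \<cdot> lsubst S) (lhs a)" if "a \<in> T" "rhs a = wild \<Sigma>" for a
    using \<tau> that by (cases a) (auto simp: Psi_def abstraction_set_def)
  ultimately show ?thesis
    by (auto simp: solves_lhs_def subst_compose_def)
qed

lemma aunif_rtranclp_more_general_lhs:
  assumes abs: "absorption_theory \<Sigma>" and wf: "wf_config \<Sigma> (A, S, T, \<theta>)"
    and deriv: "(aunif \<Sigma>)\<^sup>*\<^sup>* (A, S, T, \<theta>) ({}, S', T', \<theta>')"
    and eq: "AUE s x t \<in> A \<union> S" "x \<notin> Dom \<theta>"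
    and \<tau>: "\<tau> \<in> Psi \<Sigma> T' S'"
  shows "more_general \<Sigma> (\<theta>' x \<cdot> \<tau>) s"
proof -
  have wf': "wf_config \<Sigma> ({}, S', T', \<theta>')"
    using aunif_rtranclp_wf_config[OF abs deriv wf] .
  obtain \<sigma> where \<sigma>: "solves_lhs \<Sigma> (lhs_obligations \<Sigma> (A, S, T, \<theta>)) \<sigma>"
    "\<theta> \<circ>\<^sub>s \<sigma> = \<theta>' \<circ>\<^sub>s (\<tau> \<circ>\<^sub>s lsubst S')"
    using aunif_rtranclp_reflects_lhs_solutions[OF abs deriv wf] Psi_solves_lhs[OF wf' \<tau>]
    unfolding reflects_lhs_solutions_def config_subst.simps by blast
  have "\<sigma> x = (\<theta> \<circ>\<^sub>s \<sigma>) x"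
    using eq(2) by (simp add: Dom_def subst_compose_def)
  also have "\<dots> = \<theta>' x \<cdot> \<tau> \<cdot> lsubst S'"
    unfolding \<sigma>(2) by (simp add: subst_compose_def flip: subst_apply_compose)
  finally have "abs_eq \<Sigma> (\<theta>' x \<cdot> \<tau> \<cdot> lsubst S') s"
    using solves_lhs_AUE[OF \<sigma>(1), of s x t] eq(1) by auto
  then show ?thesis
    using wf_config_is_subst_lsubst[OF wf'] by (auto simp: more_general_def)
qed


subsection \<open>Exchanging the two sides\<close>

fun mirror :: "('f, 'v) aue \<Rightarrow> ('f, 'v) aue" where
  "mirror (AUE s x t) = AUE t x s"

fun mirror_config :: "('f, 'v) config \<Rightarrow> ('f, 'v) config" where
  "mirror_config (A, S, T, \<theta>) = (mirror ` A, mirror ` S, mirror ` T, \<theta>)"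

lemma mirror_sel [simp]: "lhs (mirror a) = rhs a" "rhs (mirror a) = lhs a" "label (mirror a) = label a"
  by (cases a; simp)+

lemma mirror_mirror [simp]: "mirror (mirror a) = a"
  by (cases a) simp

lemma AUE_in_mirror_image [simp]: "AUE s x t \<in> mirror ` W \<longleftrightarrow> AUE t x s \<in> W"
  by (metis image_iff mirror.simps mirror_mirror)

lemma labels_mirror [simp]: "labels (mirror ` W) = labels W"
  by (simp add: labels_def image_image)

lemma inj_mirror: "inj mirror"
  by (metis injI mirror_mirror)

lemma inj_on_label_mirror [simp]: "inj_on label (mirror ` W) \<longleftrightarrow> inj_on label W"
  by (simp add: inj_on_def image_iff) (metis mirror_mirror mirror_sel(3))

lemma wf_config_mirror: "wf_config \<Sigma> C \<Longrightarrow> wf_config \<Sigma> (mirror_config C)"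
  by (cases C)
    (auto simp: wf_aue_def simp flip: image_Un image_Int[OF inj_mirror])

lemma config_vars_mirror [simp]: "config_vars (mirror_config C) = config_vars C"
  by (cases C) (auto simp: aue_vars_def simp flip: image_Un)

lemma fresh_mirror: "fresh ys C \<Longrightarrow> fresh ys (mirror_config C)"
  by (simp add: fresh_def)

lemma related_commute: "related \<Sigma> h k \<longleftrightarrow> related \<Sigma> k h"
  by (auto simp: related_def)

lemma aunif_mirror: "aunif \<Sigma> C C' \<Longrightarrow> aunif \<Sigma> (mirror_config C) (mirror_config C')"
proof (induction rule: aunif.induct)
  case (Dec f ss x ts A ys S T \<theta>)
  have "mirror ` {AUE (ss ! i) (ys ! i) (ts ! i) | i. i < length ys} =
      {AUE (ts ! i) (ys ! i) (ss ! i) | i. i < length ys}"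
    by (auto simp: image_iff) force
  with Dec show ?case
    using fresh_mirror[OF Dec(4)] by (simp add: image_Un aunif.Dec)
next
  case Sol
  then show ?case
    by (simp add: aunif.Sol related_commute)
next
  case ExpLA1
  then show ?case
    using fresh_mirror[OF ExpLA1(3)] by (simp add: aunif.ExpRA1)
next
  case ExpLA2
  then show ?case
    using fresh_mirror[OF ExpLA2(3)] by (simp add: aunif.ExpRA2)
next
  case ExpRA1
  then show ?case
    using fresh_mirror[OF ExpRA1(3)] by (simp add: aunif.ExpLA1)
next
  case ExpRA2
  then show ?case
    using fresh_mirror[OF ExpRA2(3)] by (simp add: aunif.ExpLA2)
next
  case Mer
  then show ?case
    by (simp add: aunif.Mer)
qed

lemma aunif_rtranclp_mirror:
  "(aunif \<Sigma>)\<^sup>*\<^sup>* C C' \<Longrightarrow> (aunif \<Sigma>)\<^sup>*\<^sup>* (mirror_config C) (mirror_config C')"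
  by (induction rule: rtranclp_induct) (auto intro: aunif_mirror rtranclp.rtrancl_into_rtrancl)

lemma lsubst_mirror:
  assumes "inj_on label W"
  shows "lsubst (mirror ` W) = rsubst W"
proof
  fix y
  show "lsubst (mirror ` W) y = rsubst W y"
  proof (cases "y \<in> labels W")
    case True
    then obtain a where "a \<in> W" "label a = y"
      by (auto simp: labels_def)
    then show ?thesis
      using assms lsubst_label[of "mirror ` W" "mirror a"] by (auto simp: rsubst_label)
  next
    case False
    then show ?thesis
      by (simp add: lsubst_def rsubst_def)
  qed
qed

lemma rsubst_mirror: "inj_on label W \<Longrightarrow> rsubst (mirror ` W) = lsubst W"
  using lsubst_mirror[of "mirror ` W"] by (simp add: image_image)

lemma Psi_mirror: "inj_on label S \<Longrightarrow> Psi \<Sigma> (mirror ` T) (mirror ` S) = Psi \<Sigma> T S"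
  by (auto simp: Psi_def lsubst_mirror rsubst_mirror)

lemma aunif_rtranclp_more_general_rhs:
  assumes abs: "absorption_theory \<Sigma>" and wf: "wf_config \<Sigma> (A, S, T, \<theta>)"
    and deriv: "(aunif \<Sigma>)\<^sup>*\<^sup>* (A, S, T, \<theta>) ({}, S', T', \<theta>')"
    and eq: "AUE s x t \<in> A \<union> S" "x \<notin> Dom \<theta>"
    and \<tau>: "\<tau> \<in> Psi \<Sigma> T' S'"
  shows "more_general \<Sigma> (\<theta>' x \<cdot> \<tau>) t"
proof (rule aunif_rtranclp_more_general_lhs[OF abs])
  show "wf_config \<Sigma> (mirror ` A, mirror ` S, mirror ` T, \<theta>)"
    using wf_config_mirror[OF wf] by simp
  show "(aunif \<Sigma>)\<^sup>*\<^sup>* (mirror ` A, mirror ` S, mirror ` T, \<theta>) ({}, mirror ` S', mirror ` T', \<theta>')"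
    using aunif_rtranclp_mirror[OF deriv] by simp
  show "AUE t x s \<in> mirror ` A \<union> mirror ` S" "x \<notin> Dom \<theta>"
    using eq by auto
  have "inj_on label S'"
    using aunif_rtranclp_wf_config[OF abs deriv wf] by (auto intro: inj_on_subset)
  then show "\<tau> \<in> Psi \<Sigma> (mirror ` T') (mirror ` S')"
    using \<tau> by (simp add: Psi_mirror)
qed

theorem theorem3:
  fixes \<Sigma> :: "'f abs_sig"
    and A0 S0 T0 Sn Tn :: "('f, 'v) aue set"
    and \<theta>0 \<theta>n :: "('f, 'v) subst"
    and s t :: "('f, 'v) trm" and x :: 'v
  assumes "absorption_theory \<Sigma>"
    and "configuration \<Sigma> (A0, S0, T0, \<theta>0)"
    and "(aunif \<Sigma>)\<^sup>*\<^sup>* (A0, S0, T0, \<theta>0) ({}, Sn, Tn, \<theta>n)"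
    and "final \<Sigma> ({}, Sn, Tn, \<theta>n)"
    and "AUE s x t \<in> A0 \<union> S0"
  shows "\<forall>\<tau> \<in> Psi \<Sigma> Tn Sn. \<theta>n x \<cdot> \<tau> \<in> generalizations \<Sigma> s t"
proof
  fix \<tau> assume \<tau>: "\<tau> \<in> Psi \<Sigma> Tn Sn"
  have wf: "wf_config \<Sigma> (A0, S0, T0, \<theta>0)"
    using assms(2) by (rule configuration_imp_wf_config)
  have "x \<in> labels A0 \<union> labels S0"
    using assms(5) by (force simp: labels_def)
  then have x: "x \<notin> Dom \<theta>0"
    using assms(2) by auto
  have "wf_subst \<Sigma> \<theta>n"
    using aunif_rtranclp_wf_config[OF assms(1,3) wf] by simp
  moreover have "wf_subst \<Sigma> \<tau>"
    using \<tau> by (simp add: Psi_def is_subst_imp_wf_subst)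
  ultimately have "wf_trm \<Sigma> (\<theta>n x \<cdot> \<tau>)"
    by (simp add: wf_subst_def[of _ \<theta>n] wf_subst_apply)
  moreover have "more_general \<Sigma> (\<theta>n x \<cdot> \<tau>) s"
    using aunif_rtranclp_more_general_lhs[OF assms(1) wf assms(3,5) x \<tau>] .
  moreover have "more_general \<Sigma> (\<theta>n x \<cdot> \<tau>) t"
    using aunif_rtranclp_more_general_rhs[OF assms(1) wf assms(3,5) x \<tau>] .
  ultimately show "\<theta>n x \<cdot> \<tau> \<in> generalizations \<Sigma> s t"
    by (simp add: generalizations_def)
qed

end
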